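(* Let $G=(V,E)$ be a finite graph with $n=|V|$ and $\mathrm{Ric}(G)\ge K$ for some $K\in\mathbb R$, and let $\rho$ be its log-Sobolev (hypercontractivity) constant. Then for every nonempty subset $A\subset V$ with $|A|\le n/2$, $$|\partial A|\ge\frac1{16}\min\Big(\sqrt\rho,\frac{\rho}{\sqrt{2|K|}}\Big)\,|A|\Big(\log\frac{n}{|A|}\Big)^{1/2},$$ where $\partial A$ is the set of edges between $A$ and $V\setminus A$ (and $\rho/\sqrt{2|K|}$ is interpreted as $+\infty$ when $K=0$).
   Context: Let $G=(V,E)$ be an undirected simple graph with no isolated vertices; $y\sim x$ means adjacency. For $f,g:V\to\mathbb R$ define $\Delta f(x)=\sum_{y\sim x}(f(y)-f(x))$, $\Gamma(f,g)(x)=\frac12\sum_{y\sim x}(f(x)-f(y))(g(x)-g(y))$, $\Gamma(f)=\Gamma(f,f)$, $\Gamma_2(f)=\frac12\Delta\Gamma(f)-\Gamma(f,\Delta f)$. "$\mathrm{Ric}(G)\ge K$" means $\Gamma_2(f)(x)\ge K\,\Gamma(f)(x)$ for all $f:V\to\mathbb R$ and $x\in V$. The heat kernel is $P_t=\exp(t\Delta)$ and $\|f\|_p=(\sum_{v}|f(v)|^p)^{1/p}$. The constant $\rho$ is the greatest value such that whenever $1<r<q<\infty$, $t\ge0$ and $\sqrt{(q-1)/(r-1)}\le e^{\rho t}$, one has $n^{-1/q}\|P_tf\|_q\le n^{-1/r}\|f\|_r$ for all $f:V\to\mathbb R$. *)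

theory Defs
  imports Complex_Main
begin

text \<open>Edges are two-element subsets of the vertex set, so \<open>x \<sim> y\<close> reads \<open>{x, y} \<in> E\<close>.
  A function \<open>V \<rightarrow> \<real>\<close> is a total function whose values off \<open>V\<close> are never inspected at
  vertices of \<open>V\<close>.\<close>

locale simple_graph =
  fixes V :: "'a set" and E :: "'a set set"
  assumes edges: "e \<in> E \<Longrightarrow> e \<subseteq> V \<and> card e = 2"
    and no_isolated: "x \<in> V \<Longrightarrow> \<exists>y. {x, y} \<in> E"

definition laplacian :: "'a set set \<Rightarrow> ('a \<Rightarrow> real) \<Rightarrow> 'a \<Rightarrow> real" where
  "laplacian E f x = (\<Sum>y | {x, y} \<in> E. f y - f x)"

definition Gam :: "'a set set \<Rightarrow> ('a \<Rightarrow> real) \<Rightarrow> ('a \<Rightarrow> real) \<Rightarrow> 'a \<Rightarrow> real" where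
  "Gam E f g x = 1/2 * (\<Sum>y | {x, y} \<in> E. (f x - f y) * (g x - g y))"

definition Gam2 :: "'a set set \<Rightarrow> ('a \<Rightarrow> real) \<Rightarrow> 'a \<Rightarrow> real" where
  "Gam2 E f x = 1/2 * laplacian E (Gam E f f) x - Gam E f (laplacian E f) x"

definition Ric_ge :: "'a set \<Rightarrow> 'a set set \<Rightarrow> real \<Rightarrow> bool" where
  "Ric_ge V E K \<longleftrightarrow> (\<forall>f. \<forall>x\<in>V. Gam2 E f x \<ge> K * Gam E f f x)"

text \<open>The heat semigroup \<open>exp (t \<Delta>)\<close>, as the exponential series of the operator \<open>t \<Delta>\<close>
  (for finite \<open>V\<close> it converges absolutely at every vertex).\<close>

definition heat :: "'a set set \<Rightarrow> real \<Rightarrow> ('a \<Rightarrow> real) \<Rightarrow> 'a \<Rightarrow> real" where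
  "heat E t f x = (\<Sum>k. t ^ k / fact k * (laplacian E ^^ k) f x)"

definition lp_norm :: "'a set \<Rightarrow> real \<Rightarrow> ('a \<Rightarrow> real) \<Rightarrow> real" where
  "lp_norm V p f = (\<Sum>v\<in>V. \<bar>f v\<bar> powr p) powr (1 / p)"

definition hypercontractive :: "'a set \<Rightarrow> 'a set set \<Rightarrow> real \<Rightarrow> bool" where
  "hypercontractive V E \<rho> \<longleftrightarrow>
    (\<forall>r q t. 1 < r \<and> r < q \<and> 0 \<le> t \<and> sqrt ((q - 1) / (r - 1)) \<le> exp (\<rho> * t) \<longrightarrow>
      (\<forall>f. real (card V) powr (- 1 / q) * lp_norm V q (heat E t f)
         \<le> real (card V) powr (- 1 / r) * lp_norm V r f))"

definition log_sobolev_const :: "'a set \<Rightarrow> 'a set set \<Rightarrow> real" where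
  "log_sobolev_const V E = (GREATEST \<rho>. hypercontractive V E \<rho>)"

definition edge_boundary :: "'a set \<Rightarrow> 'a set set \<Rightarrow> 'a set \<Rightarrow> 'a set set" where
  "edge_boundary V E A = {e \<in> E. \<exists>x\<in>A. \<exists>y\<in>V - A. e = {x, y}}"

end

theory Submission imports Defs "HOL-Library.Indicator_Function" begin

text \<open>Write \<open>P\<^sub>t\<close> for the heat semigroup and \<open>f\<close> for the indicator of \<open>A\<close>. As long as
  \<open>2 K t \<ge> -1\<close>, the curvature bound makes \<open>(P\<^sub>s f)\<^sup>2 + s \<Gamma>(P\<^sub>s f)\<close>, \<open>0 \<le> s \<le> t\<close>, a subsolution of the
  heat equation, so \<open>t \<Gamma>(P\<^sub>t f) \<le> P\<^sub>t f - (P\<^sub>t f)\<^sup>2 \<le> 1/4\<close>. Hence the heat flowing out of \<open>A\<close> up to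
  time \<open>t\<close> is at most \<open>sqrt (2 t)\<close> times the size of the edge boundary. On the other hand the heat
  remaining in \<open>A\<close> at time \<open>t\<close> is the squared 2-norm of \<open>P\<^bsub>t/2\<^esub> f\<close>, which hypercontractivity bounds
  by \<open>|A|\<close> times \<open>|A|/n\<close> to the power \<open>tanh (\<rho> t / 2)\<close>. The theorem follows with \<open>t\<close> the smaller of
  \<open>1 / (\<rho> log (n/|A|))\<close> and \<open>1 / (2 |K|)\<close>.\<close>

subsection \<open>Real inequalities\<close>

lemma DERIV_min_zero_power2:
  "((\<lambda>x::real. (min x 0)\<^sup>2) has_real_derivative 2 * min x 0) (at x)"
  unfolding has_field_derivative_iff
proof (rule LIM_imp_LIM[OF tendsto_ident_at])
  fix y :: real assume "y \<noteq> x"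
  have "\<bar>(min y 0)\<^sup>2 - (min x 0)\<^sup>2 - 2 * min x 0 * (y - x)\<bar> \<le> \<bar>y - x\<bar> * \<bar>y - x\<bar>"
  proof (cases "x \<le> 0"; cases "y \<le> 0")
    assume "x \<le> 0" "y \<le> 0"
    then show ?thesis
      using sum_squares_bound[of x y] by (simp add: power2_eq_square abs_if algebra_simps)
  next
    assume "x \<le> 0" "\<not> y \<le> 0"
    then have "x * (y * 2) \<le> x * x"
      using mult_nonpos_nonneg[of x y] by (intro order_trans[OF _ zero_le_square]) simp
    then show ?thesis
      using \<open>x \<le> 0\<close> \<open>\<not> y \<le> 0\<close> by (simp add: min_def power2_eq_square abs_if algebra_simps)
  next
    assume "\<not> x \<le> 0" "y \<le> 0"
    then show ?thesis
      using mult_nonneg_nonpos[of x y] by (simp add: min_def power2_eq_square algebra_simps)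
  qed (simp add: min_def)
  moreover have "((min y 0)\<^sup>2 - (min x 0)\<^sup>2) / (y - x) - 2 * min x 0
      = ((min y 0)\<^sup>2 - (min x 0)\<^sup>2 - 2 * min x 0 * (y - x)) / (y - x)"
    using \<open>y \<noteq> x\<close> by (simp add: diff_divide_distrib)
  ultimately show "norm (((min y 0)\<^sup>2 - (min x 0)\<^sup>2) / (y - x) - 2 * min x 0) \<le> norm (y - x)"
    using \<open>y \<noteq> x\<close> by (simp only: real_norm_def abs_divide) (simp add: pos_divide_le_eq)
qed

lemma mult_ge_minus_one_mono:
  fixes c s t :: real
  assumes "0 \<le> s" "s \<le> t" "- 1 \<le> c * t"
  shows "- 1 \<le> c * s"
proof (cases "0 \<le> c")
  case True
  then have "0 \<le> c * s" using \<open>0 \<le> s\<close> by simp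
  then show ?thesis by linarith
next
  case False
  then have "c * t \<le> c * s" using \<open>s \<le> t\<close> by (intro mult_left_mono_neg) auto
  then show ?thesis using assms(3) by linarith
qed

lemma two_divide_one_plus_exp_eq_tanh: "2 / (1 + exp (- (2 * u))) = 1 + tanh (u::real)"
  using add_pos_pos[OF zero_less_one exp_gt_zero, of "- (2 * u)"]
  by (simp add: tanh_real_altdef field_simps)

lemma tanh_ge_divide_one_plus:
  fixes x :: real
  assumes "0 \<le> x"
  shows "x / (1 + x) \<le> tanh x"
proof -
  have "exp (- (2 * x)) \<le> 1 / (1 + 2 * x)"
    using exp_ge_add_one_self[of "2 * x"] assms by (simp add: exp_minus field_simps)
  then have "2 / (1 + 1 / (1 + 2 * x)) \<le> 2 / (1 + exp (- (2 * x)))"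
    using assms by (intro divide_left_mono mult_pos_pos add_pos_pos) auto
  moreover have "2 / (1 + 1 / (1 + 2 * x)) = 1 + x / (1 + x)"
    using assms by (simp add: field_simps)
  ultimately show ?thesis
    by (simp add: two_divide_one_plus_exp_eq_tanh)
qed

lemma one_minus_exp_minus_ge:
  fixes x :: real
  assumes "0 \<le> x"
  shows "x / (1 + x) \<le> 1 - exp (- x)"
  using assms exp_ge_add_one_self[of x] by (simp add: exp_minus field_simps)

lemma one_minus_exp_mult_tanh_ge:
  fixes u L :: real
  assumes "0 \<le> u" "1 / 2 \<le> L" "u * L \<le> 1"
  shows "u * L / 5 \<le> 1 - exp (- (L * tanh (u / 2)))"
proof -
  define z where "z = u * L / 4"
  have z_bounds: "0 \<le> z" "z \<le> 1 / 4" using assms by (simp_all add: z_def)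
  have "u \<le> 2" using assms mult_left_mono[of "1/2" L u] by linarith
  then have "u / 4 \<le> (u / 2) / (1 + u / 2)"
    using assms(1) mult_left_mono[of u 2 u] by (simp add: field_simps)
  also have "\<dots> \<le> tanh (u / 2)"
    using assms(1) by (intro tanh_ge_divide_one_plus) simp
  finally have "z \<le> L * tanh (u / 2)"
    using assms(2) mult_left_mono[of "u / 4" "tanh (u / 2)" L] by (simp add: z_def mult.commute)
  then have "1 - exp (- z) \<le> 1 - exp (- (L * tanh (u / 2)))" by simp
  moreover have "z / (1 + z) \<le> 1 - exp (- z)"
    using z_bounds by (intro one_minus_exp_minus_ge) simp
  moreover have "4 / 5 * z \<le> z / (1 + z)"
    using z_bounds mult_left_mono[of z "1 / 4" z] by (simp add: field_simps)
  ultimately have "4 / 5 * z \<le> 1 - exp (- (L * tanh (u / 2)))" by linarith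
  then show ?thesis by (simp add: z_def mult.commute)
qed

lemma min_sqrt_divide_sqrt_mult_le:
  fixes \<rho> \<kappa> L :: real
  assumes "0 < \<rho>" "0 \<le> \<kappa>" "1 / 2 \<le> L"
  shows "(if \<kappa> = 0 then sqrt \<rho> else min (sqrt \<rho>) (\<rho> / sqrt \<kappa>)) * sqrt L
    \<le> 2 * (\<rho> * L * sqrt (1 / max (\<rho> * L) \<kappa>))" (is "?m * _ \<le> _")
proof (cases "\<kappa> \<le> \<rho> * L")
  case True
  have "?m * sqrt L \<le> sqrt \<rho> * sqrt L"
    using assms by (intro mult_right_mono) auto
  also have "\<dots> = \<rho> * L * sqrt (1 / (\<rho> * L))"
    using assms by (simp add: real_sqrt_divide real_sqrt_mult field_simps)
  also have "\<dots> \<le> 2 * (\<rho> * L * sqrt (1 / (\<rho> * L)))"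
    using assms by simp
  finally show ?thesis
    using True by (simp only: max_absorb1)
next
  case False
  then have "0 < \<kappa>" using assms mult_pos_pos[of \<rho> L] by linarith
  have "sqrt L \<le> 2 * L"
    using assms mult_left_mono[of "1/2" L L]
    by (intro real_le_lsqrt) (auto simp: power2_eq_square)
  then have "?m * sqrt L \<le> \<rho> / sqrt \<kappa> * (2 * L)"
    using assms \<open>0 < \<kappa>\<close> by (intro mult_mono) auto
  also have "\<dots> = 2 * (\<rho> * L * sqrt (1 / max (\<rho> * L) \<kappa>))"
    using False by (simp add: max_absorb2 real_sqrt_divide)
  finally show ?thesis .
qed

subsection \<open>Hypercontractivity\<close>

definition mean_lp_norm :: "'a set \<Rightarrow> real \<Rightarrow> ('a \<Rightarrow> real) \<Rightarrow> real" where
  "mean_lp_norm V p f = real (card V) powr (- 1 / p) * lp_norm V p f"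

lemma hypercontractive_iff:
  "hypercontractive V E \<rho> \<longleftrightarrow>
    (\<forall>r q t f. 1 < r \<and> r < q \<and> 0 \<le> t \<and> sqrt ((q - 1) / (r - 1)) \<le> exp (\<rho> * t) \<longrightarrow>
      mean_lp_norm V q (heat E t f) \<le> mean_lp_norm V r f)"
  unfolding hypercontractive_def mean_lp_norm_def by blast

lemma mean_lp_norm_2_power2: "(mean_lp_norm V 2 f)\<^sup>2 = (\<Sum>v\<in>V. (f v)\<^sup>2) / card V"
  by (simp add: mean_lp_norm_def lp_norm_def sum_nonneg power_mult_distrib powr_half_sqrt
      powr_minus_divide power_divide)

lemma mean_lp_norm_indicator:
  assumes "finite V" "A \<subseteq> V"
  shows "mean_lp_norm V p (indicat_real A) = (real (card A) / real (card V)) powr (1 / p)"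
proof -
  have "(\<Sum>v\<in>V. \<bar>indicat_real A v\<bar> powr p) = (\<Sum>v\<in>A. 1)"
    using assms by (intro sum.mono_neutral_cong_right) (auto simp: indicator_def)
  then show ?thesis
    by (simp add: mean_lp_norm_def lp_norm_def powr_divide powr_minus_divide)
qed

lemma tendsto_mean_lp_norm:
  assumes "finite V" "0 < q"
  shows "((\<lambda>p. mean_lp_norm V p f) \<longlongrightarrow> mean_lp_norm V q f) (at q within S)"
proof (cases "\<forall>v\<in>V. f v = 0")
  case True
  then show ?thesis by (simp add: mean_lp_norm_def lp_norm_def)
next
  case False
  then obtain v where "v \<in> V" "f v \<noteq> 0" by blast
  then have "(\<Sum>v\<in>V. \<bar>f v\<bar> powr q) > 0" and "card V > 0"
    using \<open>finite V\<close> by (auto intro!: sum_pos2[of V v] simp: card_gt_0_iff)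
  moreover have "((\<lambda>p. \<bar>f v\<bar> powr p) \<longlongrightarrow> \<bar>f v\<bar> powr q) (at q within S)" for v
    by (cases "f v = 0") (auto intro!: tendsto_intros)
  ultimately show ?thesis
    unfolding mean_lp_norm_def lp_norm_def using \<open>0 < q\<close> by (intro tendsto_intros) auto
qed

lemma hypercontractive_nonpos:
  assumes "\<rho> \<le> 0"
  shows "hypercontractive V E \<rho>"
proof -
  have "\<not> sqrt ((q - 1) / (r - 1)) \<le> exp (\<rho> * t)" if "1 < r" "r < q" "0 \<le> t" for r q t :: real
  proof -
    have "exp (\<rho> * t) \<le> 1" using assms that by (simp add: mult_nonpos_nonneg)
    also have "1 < sqrt ((q - 1) / (r - 1))" using that by simp
    finally show ?thesis by simp
  qed
  then show ?thesis by (auto simp: hypercontractive_iff)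
qed

text \<open>In the borderline case of the time condition, approximate \<open>q\<close> from below.\<close>

lemma hypercontractive_Sup:
  assumes "finite V" "S \<noteq> {}" "bdd_above S"
    and hyper: "\<And>\<rho>. \<rho> \<in> S \<Longrightarrow> hypercontractive V E \<rho>"
  shows "hypercontractive V E (Sup S)"
  unfolding hypercontractive_iff
proof (intro allI impI, elim conjE)
  fix r q t f
  assume "1 < r" "r < q" "0 \<le> t" and time: "sqrt ((q - 1) / (r - 1)) \<le> exp (Sup S * t)"
  have "0 < t" using \<open>0 \<le> t\<close> \<open>1 < r\<close> \<open>r < q\<close> time by (cases "t = 0") auto
  have "mean_lp_norm V p (heat E t f) \<le> mean_lp_norm V r f" if "r < p" "p < q" for p
  proof -
    let ?u = "sqrt ((p - 1) / (r - 1))"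
    have "0 < ?u" using \<open>1 < r\<close> that by simp
    have "?u < sqrt ((q - 1) / (r - 1))"
      using \<open>1 < r\<close> that by (simp add: divide_strict_right_mono)
    also note time
    finally have "ln ?u < Sup S * t"
      using \<open>0 < ?u\<close> by (metis exp_gt_zero ln_exp ln_less_cancel_iff)
    then have "ln ?u / t < Sup S" using \<open>0 < t\<close> by (simp add: field_simps)
    then obtain \<sigma> where "\<sigma> \<in> S" "ln ?u / t < \<sigma>"
      using assms less_cSup_iff by blast
    then have "ln ?u \<le> \<sigma> * t" using \<open>0 < t\<close> by (simp add: field_simps)
    then have "?u \<le> exp (\<sigma> * t)"
      using \<open>0 < ?u\<close> by (metis exp_le_cancel_iff exp_ln)
    then show ?thesis
      using hyper[OF \<open>\<sigma> \<in> S\<close>] that \<open>1 < r\<close> \<open>0 \<le> t\<close> unfolding hypercontractive_iff by blast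
  qed
  then have "\<forall>\<^sub>F p in at_left q. mean_lp_norm V p (heat E t f) \<le> mean_lp_norm V r f"
    using \<open>r < q\<close> by (auto simp: eventually_at_left_field)
  moreover have "((\<lambda>p. mean_lp_norm V p (heat E t f))
      \<longlongrightarrow> mean_lp_norm V q (heat E t f)) (at_left q)"
    using \<open>finite V\<close> \<open>1 < r\<close> \<open>r < q\<close> by (intro tendsto_mean_lp_norm) auto
  ultimately show "mean_lp_norm V q (heat E t f) \<le> mean_lp_norm V r f"
    by (intro tendsto_upperbound) auto
qed

lemma hypercontractive_mean_l2_norm_le:
  assumes "hypercontractive V E \<rho>" "0 < \<rho>" "0 < t"
  shows "mean_lp_norm V 2 (heat E t f) \<le> mean_lp_norm V (1 + exp (- (2 * \<rho> * t))) f"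
proof -
  have "sqrt ((2 - 1) / (1 + exp (- (2 * \<rho> * t)) - 1)) = exp (\<rho> * t)"
    by (rule real_sqrt_unique)
      (simp_all add: exp_minus inverse_eq_divide mult.assoc flip: exp_double)
  then show ?thesis
    using assms unfolding hypercontractive_iff by simp
qed

subsection \<open>Calculus on a finite graph\<close>

locale finite_graph = simple_graph V E for V :: "'a set" and E :: "'a set set" +
  assumes finite_V: "finite V"
begin

abbreviation \<Delta> :: "('a \<Rightarrow> real) \<Rightarrow> 'a \<Rightarrow> real" where
  "\<Delta> \<equiv> laplacian E"

abbreviation \<Gamma> :: "('a \<Rightarrow> real) \<Rightarrow> ('a \<Rightarrow> real) \<Rightarrow> 'a \<Rightarrow> real" where
  "\<Gamma> \<equiv> Gam E"

abbreviation \<Gamma>\<^sub>2 :: "('a \<Rightarrow> real) \<Rightarrow> 'a \<Rightarrow> real" where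
  "\<Gamma>\<^sub>2 \<equiv> Gam2 E"

abbreviation P :: "real \<Rightarrow> ('a \<Rightarrow> real) \<Rightarrow> 'a \<Rightarrow> real" where
  "P \<equiv> heat E"

definition adj :: "'a \<Rightarrow> 'a \<Rightarrow> real" where
  "adj x y = of_bool ({x, y} \<in> E)"

definition inner_V :: "('a \<Rightarrow> real) \<Rightarrow> ('a \<Rightarrow> real) \<Rightarrow> real" (\<open>\<langle>_, _\<rangle>\<close>) where
  "\<langle>f, g\<rangle> = (\<Sum>x\<in>V. f x * g x)"

lemma adj_sym: "adj x y = adj y x"
  by (simp add: adj_def insert_commute)

lemma adj_nonneg [simp]: "0 \<le> adj x y"
  by (simp add: adj_def)

lemma sum_neighbours: "(\<Sum>y | {x, y} \<in> E. g y) = (\<Sum>y\<in>V. adj x y * g y)"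
proof -
  have "{y. {x, y} \<in> E} = {y \<in> V. {x, y} \<in> E}"
    using edges by auto
  then have "(\<Sum>y | {x, y} \<in> E. g y) = (\<Sum>y\<in>V. if {x, y} \<in> E then g y else 0)"
    by (simp add: sum.inter_filter finite_V)
  also have "\<dots> = (\<Sum>y\<in>V. adj x y * g y)"
    by (intro sum.cong) (auto simp: adj_def)
  finally show ?thesis .
qed

lemma laplacian_eq_sum_adj: "\<Delta> f x = (\<Sum>y\<in>V. adj x y * (f y - f x))"
  by (simp add: laplacian_def sum_neighbours)

lemma Gam_eq_sum_adj: "\<Gamma> f g x = 1/2 * (\<Sum>y\<in>V. adj x y * ((f x - f y) * (g x - g y)))"
  by (simp add: Gam_def sum_neighbours)

lemma Gam_commute: "\<Gamma> f g x = \<Gamma> g f x"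
  by (simp add: Gam_def mult.commute)

lemma Gam_nonneg: "0 \<le> \<Gamma> f f x"
  by (simp add: Gam_eq_sum_adj sum_nonneg)

lemma diff_power2_le_Gam:
  assumes "{x, y} \<in> E"
  shows "(f x - f y)\<^sup>2 \<le> 2 * \<Gamma> f f x"
proof -
  have "y \<in> V" using edges[OF assms] by auto
  then have "adj x y * ((f x - f y) * (f x - f y)) \<le> (\<Sum>y\<in>V. adj x y * ((f x - f y) * (f x - f y)))"
    using finite_V by (intro member_le_sum) auto
  then show ?thesis
    using assms by (simp add: Gam_eq_sum_adj adj_def power2_eq_square)
qed

lemma laplacian_power2: "\<Delta> (\<lambda>y. (f y)\<^sup>2) x = 2 * f x * \<Delta> f x + 2 * \<Gamma> f f x"
  by (simp add: laplacian_eq_sum_adj Gam_eq_sum_adj sum_distrib_left flip: sum.distrib)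
    (intro sum.cong refl, simp add: power2_eq_square algebra_simps)

lemma laplacian_add_cmult: "\<Delta> (\<lambda>y. f y + c * g y) x = \<Delta> f x + c * \<Delta> g x"
  by (simp add: laplacian_eq_sum_adj sum_distrib_left flip: sum.distrib)
    (intro sum.cong refl, simp add: algebra_simps)

lemma inner_V_indicator:
  assumes "A \<subseteq> V"
  shows "\<langle>indicat_real A, f\<rangle> = sum f A" and "\<langle>f, indicat_real A\<rangle> = sum f A"
  using assms by (simp_all add: inner_V_def finite_V Int_absorb1)

lemma inner_V_commute: "\<langle>f, g\<rangle> = \<langle>g, f\<rangle>"
  by (simp add: inner_V_def mult.commute)

lemma inner_V_laplacian: "\<langle>f, \<Delta> g\<rangle> = - (\<Sum>x\<in>V. \<Gamma> f g x)"
proof -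
  have "\<langle>f, \<Delta> g\<rangle> = (\<Sum>x\<in>V. \<Sum>y\<in>V. adj x y * (f x * (g y - g x)))" (is "_ = ?S")
    by (simp add: inner_V_def laplacian_eq_sum_adj sum_distrib_left mult.left_commute)
  moreover have "?S = (\<Sum>x\<in>V. \<Sum>y\<in>V. adj x y * (f y * (g x - g y)))" (is "_ = ?S'")
    by (subst sum.swap) (simp add: adj_sym)
  moreover have "?S + ?S' = - (\<Sum>x\<in>V. \<Sum>y\<in>V. adj x y * ((f x - f y) * (g x - g y)))"
    by (simp add: algebra_simps flip: sum.distrib sum_negf)
  ultimately show ?thesis
    by (simp add: Gam_eq_sum_adj flip: sum_divide_distrib)
qed

lemma laplacian_selfadjoint: "\<langle>f, \<Delta> g\<rangle> = \<langle>\<Delta> f, g\<rangle>"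
  by (simp add: inner_V_commute[of "\<Delta> f"] inner_V_laplacian Gam_commute)

subsection \<open>The heat semigroup\<close>

lemma abs_laplacian_le:
  assumes "\<And>y. y \<in> V \<Longrightarrow> \<bar>f y\<bar> \<le> M" "x \<in> V"
  shows "\<bar>\<Delta> f x\<bar> \<le> 2 * real (card V) * M"
proof -
  have "\<bar>\<Delta> f x\<bar> \<le> (\<Sum>y\<in>V. \<bar>adj x y * (f y - f x)\<bar>)"
    unfolding laplacian_eq_sum_adj by (rule sum_abs)
  also have "\<dots> \<le> (\<Sum>y\<in>V. 2 * M)"
  proof (rule sum_mono)
    fix y assume "y \<in> V"
    then show "\<bar>adj x y * (f y - f x)\<bar> \<le> 2 * M"
      using assms(1)[of y] assms(1)[OF \<open>x \<in> V\<close>] by (auto simp: adj_def)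
  qed
  finally show ?thesis by simp
qed

lemma abs_laplacian_funpow_le:
  assumes "\<And>y. y \<in> V \<Longrightarrow> \<bar>f y\<bar> \<le> M" "x \<in> V"
  shows "\<bar>(\<Delta> ^^ k) f x\<bar> \<le> (2 * real (card V)) ^ k * M"
  using assms(2)
proof (induction k arbitrary: x)
  case 0
  then show ?case using assms(1) by simp
next
  case (Suc k)
  then show ?case
    using abs_laplacian_le[of "(\<Delta> ^^ k) f" "(2 * real (card V)) ^ k * M" x] by simp
qed

lemma heat_sums:
  assumes "x \<in> V"
  shows "(\<lambda>k. t ^ k / fact k * (\<Delta> ^^ k) f x) sums P t f x"
  unfolding heat_def
proof (rule summable_sums, rule summable_comparison_test')
  define M where "M = (\<Sum>y\<in>V. \<bar>f y\<bar>)"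
  have abs_le_M: "\<bar>f y\<bar> \<le> M" if "y \<in> V" for y
    unfolding M_def using that finite_V by (intro member_le_sum) auto
  show "summable (\<lambda>k. M * (inverse (fact k) * (\<bar>t\<bar> * (2 * real (card V))) ^ k))"
    by (intro summable_mult summable_exp)
  fix k :: nat
  have "\<bar>t\<bar> ^ k / fact k * \<bar>(\<Delta> ^^ k) f x\<bar> \<le> \<bar>t\<bar> ^ k / fact k * ((2 * real (card V)) ^ k * M)"
    by (intro mult_left_mono abs_laplacian_funpow_le abs_le_M assms) auto
  then show "norm (t ^ k / fact k * (\<Delta> ^^ k) f x)
      \<le> M * (inverse (fact k) * (\<bar>t\<bar> * (2 * real (card V))) ^ k)"
    by (simp add: abs_mult power_abs divide_inverse mult_ac power_mult_distrib)
qed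

lemma heat_0 [simp]: "P 0 f x = f x"
proof -
  have "P 0 f x = (\<Sum>k. ((\<Delta> ^^ k) f x / fact k) * 0 ^ k)"
    unfolding heat_def by (intro suminf_cong) simp
  then show ?thesis by (simp only: powser_zero) simp
qed

lemma heat_laplacian:
  assumes "x \<in> V"
  shows "P t (\<Delta> f) x = \<Delta> (P t f) x"
proof -
  let ?T = "\<lambda>k y. t ^ k / fact k * (\<Delta> ^^ k) f y"
  have "(\<lambda>k. \<Sum>y\<in>V. adj x y * (?T k y - ?T k x)) sums \<Delta> (P t f) x"
    unfolding laplacian_eq_sum_adj[of "P t f"]
    using assms by (intro sums_sum sums_mult sums_diff heat_sums)
  moreover have "(\<Sum>y\<in>V. adj x y * (?T k y - ?T k x)) = t ^ k / fact k * (\<Delta> ^^ k) (\<Delta> f) x" for k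
    by (simp add: funpow_swap1[symmetric] laplacian_eq_sum_adj[of "(\<Delta> ^^ _) f"]
        sum_distrib_left right_diff_distrib mult.left_commute)
  ultimately show ?thesis
    using heat_sums[OF assms, of t "\<Delta> f"] sums_unique2 by fastforce
qed

lemma DERIV_heat:
  assumes "x \<in> V"
  shows "((\<lambda>t. P t f x) has_real_derivative \<Delta> (P t f) x) (at t)"
proof -
  let ?c = "\<lambda>k. (\<Delta> ^^ k) f x / fact k"
  have sums: "(\<lambda>k. ?c k * t ^ k) sums P t f x" for t
    using heat_sums[OF assms, of t f] by (simp add: mult.commute)
  then have "((\<lambda>t. \<Sum>k. ?c k * t ^ k) has_real_derivative (\<Sum>k. diffs ?c k * t ^ k)) (at t)"
    by (intro termdiffs_strong_converges_everywhere sums_summable)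
  moreover have "(\<Sum>k. diffs ?c k * t ^ k) = P t (\<Delta> f) x"
    unfolding heat_def
    by (intro suminf_cong) (simp add: diffs_def funpow_swap1 del: of_nat_Suc)
  ultimately show ?thesis
    using sums by (simp add: heat_laplacian assms sums_iff)
qed

lemma DERIV_heat_chain [derivative_intros]:
  assumes "x \<in> V" "(\<tau> has_real_derivative D) (at s)"
  shows "((\<lambda>s. P (\<tau> s) f x) has_real_derivative \<Delta> (P (\<tau> s) f) x * D) (at s)"
  using assms by (rule DERIV_chain2[OF DERIV_heat])

text \<open>Energy method: by Green's formula the squared norm of the negative part of a solution of
  the heat equation does not increase.\<close>

lemma heat_nonneg:
  assumes f_nonneg: "\<And>y. y \<in> V \<Longrightarrow> 0 \<le> f y" and "0 \<le> t" "x \<in> V"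
  shows "0 \<le> P t f x"
proof -
  define neg where "neg s y = min (P s f y) 0" for s y
  define energy where "energy s = (\<Sum>y\<in>V. (neg s y)\<^sup>2)" for s
  have deriv: "(energy has_real_derivative 2 * \<langle>neg s, \<Delta> (P s f)\<rangle>) (at s)" for s
    unfolding energy_def neg_def inner_V_def sum_distrib_left mult.assoc[symmetric]
    by (intro DERIV_sum DERIV_chain2[OF DERIV_min_zero_power2] DERIV_heat)
  have nonpos: "2 * \<langle>neg s, \<Delta> (P s f)\<rangle> \<le> 0" for s
  proof -
    have "0 \<le> (neg s y - neg s z) * (P s f y - P s f z)" for y z
      by (auto simp: neg_def min_def zero_le_mult_iff)
    then show ?thesis
      by (simp add: inner_V_laplacian Gam_eq_sum_adj sum_nonneg)
  qed
  have "energy t \<le> energy 0"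
    using \<open>0 \<le> t\<close> by (rule DERIV_nonpos_imp_nonincreasing) (use deriv nonpos in blast)
  also have "energy 0 = 0"
    using f_nonneg by (simp add: energy_def neg_def min_absorb2)
  finally have "energy t = 0"
    by (simp add: energy_def sum_nonneg order.antisym)
  then have "neg t x = 0"
    using \<open>x \<in> V\<close> by (simp add: energy_def sum_nonneg_eq_0_iff finite_V)
  then show ?thesis by (simp add: neg_def min_def split: if_splits)
qed

lemma DERIV_inner_heat:
  assumes "\<And>y. y \<in> V \<Longrightarrow> ((\<lambda>s. F s y) has_real_derivative \<Delta> (F s) y + R y) (at s)"
  shows "((\<lambda>s. \<langle>P (t - s) g, F s\<rangle>) has_real_derivative \<langle>P (t - s) g, R\<rangle>) (at s)"
proof -
  have "((\<lambda>s. \<langle>P (t - s) g, F s\<rangle>) has_real_derivative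
      (\<Sum>y\<in>V. - \<Delta> (P (t - s) g) y * F s y + (\<Delta> (F s) y + R y) * P (t - s) g y)) (at s)"
    unfolding inner_V_def by (auto intro!: derivative_eq_intros assms)
  also have "(\<Sum>y\<in>V. - \<Delta> (P (t - s) g) y * F s y + (\<Delta> (F s) y + R y) * P (t - s) g y)
      = \<langle>P (t - s) g, \<Delta> (F s)\<rangle> - \<langle>\<Delta> (P (t - s) g), F s\<rangle> + \<langle>P (t - s) g, R\<rangle>"
    by (simp add: inner_V_def algebra_simps flip: sum.distrib sum_subtractf)
  finally show ?thesis by (simp add: laplacian_selfadjoint)
qed

lemma inner_heat_heat: "\<langle>P (t - s) g, P s f\<rangle> = \<langle>P t g, f\<rangle>"
proof -
  have "((\<lambda>s. \<langle>P (t - s) g, P s f\<rangle>) has_real_derivative \<langle>P (t - s) g, \<lambda>_. 0\<rangle>) (at s)" for s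
    by (intro DERIV_inner_heat) (simp add: DERIV_heat)
  then have "(\<lambda>s. \<langle>P (t - s) g, P s f\<rangle>) s = (\<lambda>s. \<langle>P (t - s) g, P s f\<rangle>) 0"
    by (intro DERIV_isconst_all) (simp add: inner_V_def)
  then show ?thesis by (simp add: inner_V_def)
qed

lemma heat_eq_inner_kernel:
  assumes "x \<in> V"
  shows "P t f x = \<langle>P t (indicat_real {x}), f\<rangle>"
proof -
  have "\<langle>P t (indicat_real {x}), f\<rangle> = \<langle>P (t - t) (indicat_real {x}), P t f\<rangle>"
    by (simp only: inner_heat_heat)
  also have "\<dots> = \<langle>indicat_real {x}, P t f\<rangle>"
    by (simp add: inner_V_def)
  also have "\<dots> = P t f x"
    using assms by (simp add: inner_V_indicator)
  finally show ?thesis by simp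
qed

lemma heat_subsolution_le:
  assumes deriv: "\<And>s y. 0 \<le> s \<Longrightarrow> s \<le> t \<Longrightarrow> y \<in> V \<Longrightarrow>
      ((\<lambda>s. F s y) has_real_derivative \<Delta> (F s) y + R s y) (at s)"
    and R_nonpos: "\<And>s y. 0 \<le> s \<Longrightarrow> s \<le> t \<Longrightarrow> y \<in> V \<Longrightarrow> R s y \<le> 0"
    and "0 \<le> t" "x \<in> V"
  shows "F t x \<le> P t (F 0) x"
proof -
  let ?k = "indicat_real {x}"
  define \<phi> where "\<phi> s = \<langle>P (t - s) ?k, F s\<rangle>" for s
  have "\<phi> t \<le> \<phi> 0"
  proof (rule DERIV_nonpos_imp_nonincreasing[OF \<open>0 \<le> t\<close>])
    fix s assume s: "0 \<le> s" "s \<le> t"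
    have "(\<phi> has_real_derivative \<langle>P (t - s) ?k, R s\<rangle>) (at s)"
      unfolding \<phi>_def using s by (intro DERIV_inner_heat deriv)
    moreover have "\<langle>P (t - s) ?k, R s\<rangle> \<le> 0"
      unfolding inner_V_def using s
      by (intro sum_nonpos mult_nonneg_nonpos heat_nonneg R_nonpos) auto
    ultimately show "\<exists>D. (\<phi> has_real_derivative D) (at s) \<and> D \<le> 0" by blast
  qed
  moreover have "\<phi> t = F t x"
    using \<open>x \<in> V\<close> inner_V_indicator(1)[of "{x}" "F t"] by (simp add: \<phi>_def inner_V_def)
  ultimately show ?thesis
    using heat_eq_inner_kernel[OF \<open>x \<in> V\<close>, of t "F 0"] by (simp add: \<phi>_def)
qed

lemma heat_mono:
  assumes "\<And>y. y \<in> V \<Longrightarrow> f y \<le> g y" "0 \<le> t" "x \<in> V"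
  shows "P t f x \<le> P t g x"
  unfolding heat_eq_inner_kernel[OF \<open>x \<in> V\<close>] inner_V_def
  using assms by (intro sum_mono mult_left_mono heat_nonneg) auto

subsection \<open>Curvature and gradient bounds\<close>

lemma DERIV_Gam_heat:
  assumes "x \<in> V"
  shows "((\<lambda>s. \<Gamma> (P s f) (P s f) x) has_real_derivative 2 * \<Gamma> (P s f) (\<Delta> (P s f)) x) (at s)"
  unfolding Gam_eq_sum_adj using assms
  by (auto intro!: derivative_eq_intros simp: sum_distrib_left algebra_simps)

lemma DERIV_heat_power2_add_Gam:
  fixes f :: "'a \<Rightarrow> real"
  defines "F \<equiv> \<lambda>s y. (P s f y)\<^sup>2 + s * \<Gamma> (P s f) (P s f) y"
  assumes "x \<in> V"
  shows "((\<lambda>s. F s x) has_real_derivative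
    \<Delta> (F s) x + (- \<Gamma> (P s f) (P s f) x - 2 * s * \<Gamma>\<^sub>2 (P s f) x)) (at s)"
proof -
  let ?u = "P s f"
  have "((\<lambda>s. F s x) has_real_derivative
      2 * ?u x * \<Delta> ?u x + (\<Gamma> ?u ?u x + s * (2 * \<Gamma> ?u (\<Delta> ?u) x))) (at s)"
    unfolding F_def using assms by (auto intro!: derivative_eq_intros DERIV_Gam_heat)
  also have "2 * ?u x * \<Delta> ?u x + (\<Gamma> ?u ?u x + s * (2 * \<Gamma> ?u (\<Delta> ?u) x))
      = \<Delta> (F s) x + (- \<Gamma> ?u ?u x - 2 * s * \<Gamma>\<^sub>2 ?u x)"
    unfolding F_def laplacian_add_cmult laplacian_power2 Gam2_def by (simp add: algebra_simps)
  finally show ?thesis .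
qed

lemma heat_power2_add_Gam_le:
  assumes Ric: "Ric_ge V E K" and "0 \<le> t" and Kt: "- 1 \<le> 2 * K * t" and "x \<in> V"
  shows "(P t f x)\<^sup>2 + t * \<Gamma> (P t f) (P t f) x \<le> P t (\<lambda>y. (f y)\<^sup>2) x"
proof -
  have "- \<Gamma> (P s f) (P s f) y - 2 * s * \<Gamma>\<^sub>2 (P s f) y \<le> 0"
    if "0 \<le> s" "s \<le> t" "y \<in> V" for s y
  proof -
    have "2 * s * (K * \<Gamma> (P s f) (P s f) y) \<le> 2 * s * \<Gamma>\<^sub>2 (P s f) y"
      using Ric that by (intro mult_left_mono) (auto simp: Ric_ge_def)
    moreover have "0 \<le> (1 + 2 * K * s) * \<Gamma> (P s f) (P s f) y"
      using mult_ge_minus_one_mono[OF that(1,2) Kt]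
      by (intro mult_nonneg_nonneg Gam_nonneg) auto
    ultimately show ?thesis by (simp add: algebra_simps)
  qed
  from heat_subsolution_le[OF DERIV_heat_power2_add_Gam this \<open>0 \<le> t\<close> \<open>x \<in> V\<close>]
  show ?thesis by simp
qed

lemma Gam_heat_le:
  assumes "Ric_ge V E K" "0 \<le> t" "- 1 \<le> 2 * K * t" "x \<in> V"
    and f_range: "f ` V \<subseteq> {0..1}"
  shows "t * \<Gamma> (P t f) (P t f) x \<le> 1/4"
proof -
  have "(P t f x)\<^sup>2 + t * \<Gamma> (P t f) (P t f) x \<le> P t (\<lambda>y. (f y)\<^sup>2) x"
    by (rule heat_power2_add_Gam_le) fact+
  also have "\<dots> \<le> P t f x"
    using f_range \<open>0 \<le> t\<close> \<open>x \<in> V\<close>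
    by (intro heat_mono) (auto simp: power2_eq_square image_subset_iff mult_left_le)
  finally have "t * \<Gamma> (P t f) (P t f) x \<le> 1/4 - (P t f x - 1/2)\<^sup>2"
    by (simp add: power2_eq_square algebra_simps)
  then show ?thesis
    using zero_le_power2[of "P t f x - 1/2"] by linarith
qed

lemma abs_heat_diff_le:
  assumes Ric: "Ric_ge V E K" and "0 < t" and Kt: "- 1 \<le> 2 * K * t" and "{x, y} \<in> E"
    and f_range: "f ` V \<subseteq> {0..1}"
  shows "\<bar>P t f x - P t f y\<bar> \<le> 1 / sqrt (2 * t)"
proof -
  have "x \<in> V" using edges[OF \<open>{x, y} \<in> E\<close>] by auto
  have "t * (P t f x - P t f y)\<^sup>2 \<le> t * (2 * \<Gamma> (P t f) (P t f) x)"
    using assms by (intro mult_left_mono diff_power2_le_Gam) auto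
  also have "\<dots> \<le> 1 / 2"
    using Gam_heat_le[OF Ric _ Kt \<open>x \<in> V\<close> f_range] \<open>0 < t\<close> by simp
  finally have "(P t f x - P t f y)\<^sup>2 \<le> 1 / (2 * t)"
    using \<open>0 < t\<close> by (simp add: field_simps)
  from real_sqrt_le_mono[OF this] show ?thesis
    by (simp add: real_sqrt_divide)
qed

subsection \<open>Heat content and the edge boundary\<close>

lemma sum_adj_eq_card_edge_boundary:
  assumes "A \<subseteq> V"
  shows "(\<Sum>x\<in>A. \<Sum>y\<in>V - A. adj x y) = card (edge_boundary V E A)"
proof -
  let ?S = "A \<times> (V - A) \<inter> {p. {fst p, snd p} \<in> E}"
  have fin: "finite (A \<times> (V - A))" using assms finite_V finite_subset by auto
  have "bij_betw (\<lambda>(x, y). {x, y}) ?S (edge_boundary V E A)"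
    by (auto simp: bij_betw_def inj_on_def doubleton_eq_iff edge_boundary_def image_iff)
  then have "card (edge_boundary V E A) = card ?S"
    by (simp add: bij_betw_same_card)
  also have "real (card ?S) = (\<Sum>p\<in>A \<times> (V - A). of_bool ({fst p, snd p} \<in> E))"
    using fin by simp
  also have "\<dots> = (\<Sum>x\<in>A. \<Sum>y\<in>V - A. adj x y)"
    by (simp add: sum.cartesian_product adj_def case_prod_beta)
  finally show ?thesis by simp
qed

lemma sum_laplacian_eq_boundary_flow:
  assumes "A \<subseteq> V"
  shows "(\<Sum>x\<in>A. \<Delta> h x) = (\<Sum>x\<in>A. \<Sum>y\<in>V - A. adj x y * (h y - h x))"
proof -
  have "(\<Sum>x\<in>A. \<Sum>y\<in>A. adj x y * (h y - h x)) = (\<Sum>x\<in>A. \<Sum>y\<in>A. adj x y * (h x - h y))"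
    by (subst sum.swap) (simp add: adj_sym)
  then have "(\<Sum>x\<in>A. \<Sum>y\<in>A. adj x y * (h y - h x)) = 0"
    by (simp add: right_diff_distrib sum_subtractf)
  moreover have "\<Delta> h x = (\<Sum>y\<in>V - A. adj x y * (h y - h x)) + (\<Sum>y\<in>A. adj x y * (h y - h x))"
    for x
    unfolding laplacian_eq_sum_adj using assms finite_V by (rule sum.subset_diff)
  ultimately show ?thesis by (simp add: sum.distrib)
qed

lemma sum_laplacian_ge:
  assumes "A \<subseteq> V"
    and diff_le: "\<And>x y. x \<in> A \<Longrightarrow> y \<in> V - A \<Longrightarrow> {x, y} \<in> E \<Longrightarrow> h x - h y \<le> c"
  shows "- (real (card (edge_boundary V E A)) * c) \<le> (\<Sum>x\<in>A. \<Delta> h x)"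
proof -
  have "- (real (card (edge_boundary V E A)) * c) = (\<Sum>x\<in>A. \<Sum>y\<in>V - A. adj x y * (- c))"
    using assms(1) by (simp add: sum_negf flip: sum_adj_eq_card_edge_boundary sum_distrib_right)
  also have "\<dots> \<le> (\<Sum>x\<in>A. \<Sum>y\<in>V - A. adj x y * (h y - h x))"
    using diff_le by (intro sum_mono) (force simp: adj_def)
  finally show ?thesis
    using assms(1) by (simp add: sum_laplacian_eq_boundary_flow)
qed

definition heat_content :: "real \<Rightarrow> 'a set \<Rightarrow> real" where
  "heat_content t A = \<langle>P t (indicat_real A), indicat_real A\<rangle>"

lemma heat_content_eq_sum: "A \<subseteq> V \<Longrightarrow> heat_content t A = (\<Sum>x\<in>A. P t (indicat_real A) x)"
  by (simp add: heat_content_def inner_V_indicator)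

lemma heat_content_0: "A \<subseteq> V \<Longrightarrow> heat_content 0 A = card A"
  by (simp add: heat_content_eq_sum)

lemma heat_content_eq_sum_power2: "heat_content t A = (\<Sum>x\<in>V. (P (t / 2) (indicat_real A) x)\<^sup>2)"
  using inner_heat_heat[of t "t / 2" "indicat_real A" "indicat_real A"]
  by (simp add: heat_content_def inner_V_def power2_eq_square)

lemma DERIV_heat_content:
  assumes "A \<subseteq> V"
  shows "((\<lambda>t. heat_content t A) has_real_derivative (\<Sum>x\<in>A. \<Delta> (P t (indicat_real A)) x)) (at t)"
  unfolding heat_content_eq_sum[OF assms] using assms by (intro DERIV_sum DERIV_heat) auto

lemma tendsto_heat_content_0:
  assumes "A \<subseteq> V"
  shows "((\<lambda>t. heat_content t A) \<longlongrightarrow> card A) (at_right 0)"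
  using DERIV_isCont[OF DERIV_heat_content[OF assms], of 0] heat_content_0[OF assms]
  by (simp add: isCont_def filterlim_at_split)

lemma heat_content_ge:
  assumes Ric: "Ric_ge V E K" and "0 \<le> t" and Kt: "- 1 \<le> 2 * K * t" and "A \<subseteq> V"
  shows "card A - sqrt (2 * t) * card (edge_boundary V E A) \<le> heat_content t A"
proof -
  define B where "B = real (card (edge_boundary V E A))"
  define \<phi> where "\<phi> s = heat_content s A + B * sqrt (2 * s)" for s
  have "\<phi> 0 \<le> \<phi> t"
  proof (rule DERIV_nonneg_imp_increasing_open[OF \<open>0 \<le> t\<close>])
    fix s assume s: "0 < s" "s < t"
    have "(\<phi> has_real_derivative
        (\<Sum>x\<in>A. \<Delta> (P s (indicat_real A)) x) + B * (1 / sqrt (2 * s))) (at s)"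
      unfolding \<phi>_def using s \<open>A \<subseteq> V\<close>
      by (auto intro!: derivative_eq_intros DERIV_heat_content simp: field_simps)
    moreover have "- (B * (1 / sqrt (2 * s))) \<le> (\<Sum>x\<in>A. \<Delta> (P s (indicat_real A)) x)"
      unfolding B_def
    proof (rule sum_laplacian_ge[OF \<open>A \<subseteq> V\<close>])
      fix x y assume "{x, y} \<in> E"
      have "- 1 \<le> 2 * K * s"
        using s by (intro mult_ge_minus_one_mono[OF _ _ Kt]) auto
      then show "P s (indicat_real A) x - P s (indicat_real A) y \<le> 1 / sqrt (2 * s)"
        using abs_heat_diff_le[OF Ric s(1) _ \<open>{x, y} \<in> E\<close>, of "indicat_real A"]
        by (simp add: image_subset_iff indicator_def)
    qed
    ultimately show "\<exists>D. (\<phi> has_real_derivative D) (at s) \<and> 0 \<le> D" by force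
  next
    show "continuous_on {0..t} \<phi>"
      unfolding \<phi>_def using \<open>A \<subseteq> V\<close>
      by (intro continuous_intros continuous_at_imp_continuous_on ballI
          DERIV_isCont[OF DERIV_heat_content])
  qed
  then show ?thesis
    using \<open>A \<subseteq> V\<close> by (simp add: \<phi>_def B_def heat_content_0 mult.commute)
qed

subsection \<open>The log-Sobolev constant\<close>

lemma heat_content_le:
  assumes hyp: "hypercontractive V E \<rho>" "0 < \<rho>" "0 < t" and "A \<subseteq> V" "A \<noteq> {}"
  shows "heat_content t A \<le> card A * (real (card A) / real (card V)) powr tanh (\<rho> * t / 2)"
proof -
  define \<mu> where "\<mu> = real (card A) / real (card V)"
  define r where "r = 1 + exp (- (2 * (\<rho> * t / 2)))"
  have "finite A" using \<open>A \<subseteq> V\<close> finite_V by (rule finite_subset)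
  then have "card A > 0" "card V > 0"
    using \<open>A \<subseteq> V\<close> \<open>A \<noteq> {}\<close> finite_V by (auto simp: card_gt_0_iff)
  then have "0 < \<mu>" by (simp add: \<mu>_def)
  have "mean_lp_norm V 2 (P (t / 2) (indicat_real A)) \<le> \<mu> powr (1 / r)"
    using hypercontractive_mean_l2_norm_le[of V E \<rho> "t / 2" "indicat_real A"] hyp \<open>A \<subseteq> V\<close> finite_V
    by (simp add: mean_lp_norm_indicator \<mu>_def r_def)
  then have "(mean_lp_norm V 2 (P (t / 2) (indicat_real A)))\<^sup>2 \<le> (\<mu> powr (1 / r))\<^sup>2"
    by (rule power_mono) (simp add: mean_lp_norm_def lp_norm_def)
  then have "heat_content t A / card V \<le> (\<mu> powr (1 / r))\<^sup>2"
    by (simp add: mean_lp_norm_2_power2 heat_content_eq_sum_power2)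
  also have "\<dots> = \<mu> powr (2 / r)"
    using \<open>0 < \<mu>\<close> by (simp add: powr_powr flip: powr_numeral)
  also have "\<dots> = \<mu> * \<mu> powr tanh (\<rho> * t / 2)"
    unfolding r_def two_divide_one_plus_exp_eq_tanh using \<open>0 < \<mu>\<close> by (simp add: powr_add)
  finally show ?thesis
    using \<open>card V > 0\<close> by (simp add: \<mu>_def field_simps)
qed

text \<open>At a small time most heat released at a vertex is still there, which would contradict
  hypercontractivity with a large constant.\<close>

lemma bdd_above_hypercontractive:
  assumes "2 \<le> card V"
  shows "bdd_above {\<rho>. hypercontractive V E \<rho>}"
proof -
  define n where "n = real (card V)"
  have "2 \<le> n" using assms by (simp add: n_def)
  obtain x where "x \<in> V" using assms by fastforce
  then have "{x} \<subseteq> V" by simp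
  have "((\<lambda>t. heat_content t {x}) \<longlongrightarrow> 1) (at_right 0)"
    using tendsto_heat_content_0[OF \<open>{x} \<subseteq> V\<close>] by simp
  moreover have "(1 / n) powr (1 / 2) < 1"
    using \<open>2 \<le> n\<close> powr_less_mono'[of "1 / n" 0 "1 / 2"] by simp
  ultimately have "\<forall>\<^sub>F t in at_right 0. (1 / n) powr (1 / 2) < heat_content t {x}"
    by (rule order_tendstoD)
  from eventually_happens[OF eventually_conj[OF eventually_at_right_less this]]
  obtain t where t: "0 < t" "(1 / n) powr (1 / 2) < heat_content t {x}"
    by auto
  have "\<forall>\<^sub>F u in at_top. 1 / 2 < tanh (u::real)"
    using tanh_real_at_top by (rule order_tendstoD) simp
  then obtain u :: real where u: "1 / 2 < tanh u"
    by (auto simp: eventually_at_top_linorder)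
  then have "0 < u" using tanh_real_pos_iff[of u] by linarith
  have "\<rho> \<le> 2 * u / t" if hyp: "hypercontractive V E \<rho>" for \<rho>
  proof (rule ccontr)
    assume "\<not> \<rho> \<le> 2 * u / t"
    then have "u < \<rho> * t / 2" using \<open>0 < t\<close> by (simp add: field_simps)
    then have "0 < \<rho>"
      using \<open>0 < t\<close> \<open>0 < u\<close> by (intro zero_less_mult_pos2[of \<rho> t]) auto
    have "1 / 2 \<le> tanh (\<rho> * t / 2)"
      using u \<open>u < \<rho> * t / 2\<close> tanh_real_less_iff[of u "\<rho> * t / 2"] by linarith
    then have "(1 / n) powr tanh (\<rho> * t / 2) \<le> (1 / n) powr (1 / 2)"
      using \<open>2 \<le> n\<close> by (intro powr_mono') auto
    then show False
      using heat_content_le[OF hyp \<open>0 < \<rho>\<close> \<open>0 < t\<close> \<open>{x} \<subseteq> V\<close>] t(2) by (simp add: n_def)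
  qed
  then show ?thesis by (intro bdd_aboveI) auto
qed

lemma
  assumes "2 \<le> card V"
  shows hypercontractive_log_sobolev_const: "hypercontractive V E (log_sobolev_const V E)"
    and log_sobolev_const_nonneg: "0 \<le> log_sobolev_const V E"
proof -
  let ?S = "{\<rho>. hypercontractive V E \<rho>}"
  have "0 \<in> ?S" by (simp add: hypercontractive_nonpos)
  note bdd = bdd_above_hypercontractive[OF assms]
  have "hypercontractive V E (Sup ?S)"
    using \<open>0 \<in> ?S\<close> bdd finite_V by (intro hypercontractive_Sup) auto
  moreover from this have "log_sobolev_const V E = Sup ?S"
    unfolding log_sobolev_const_def using cSup_upper[OF _ bdd] by (intro Greatest_equality) auto
  ultimately show "hypercontractive V E (log_sobolev_const V E)" "0 \<le> log_sobolev_const V E"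
    using cSup_upper[OF \<open>0 \<in> ?S\<close> bdd] by simp_all
qed

subsection \<open>The isoperimetric inequality\<close>

lemma edge_boundary_ge_heat_loss:
  assumes "Ric_ge V E K" "hypercontractive V E \<rho>" "0 < \<rho>" "0 < t" "- 1 \<le> 2 * K * t"
    and "A \<subseteq> V" "A \<noteq> {}"
  shows "card A * (1 - (real (card A) / real (card V)) powr tanh (\<rho> * t / 2))
    \<le> sqrt (2 * t) * card (edge_boundary V E A)"
  using heat_content_ge[of K t A] heat_content_le[of \<rho> t A] assms by (simp add: algebra_simps)

lemma edge_boundary_ge_sqrt_time:
  assumes "Ric_ge V E K" and hyp: "hypercontractive V E \<rho>" "0 < \<rho>"
    and t: "0 < t" "- 1 \<le> 2 * K * t" and "A \<subseteq> V" "A \<noteq> {}"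
  defines "L \<equiv> ln (real (card V) / real (card A))"
  assumes L_bounds: "1 / 2 \<le> L" "\<rho> * t * L \<le> 1"
  shows "card A * (\<rho> * L * sqrt t) \<le> 8 * card (edge_boundary V E A)"
proof -
  define a where "a = real (card A)"
  define B where "B = real (card (edge_boundary V E A))"
  have "finite A" using \<open>A \<subseteq> V\<close> finite_V by (rule finite_subset)
  then have "0 < a" "0 < card V"
    using \<open>A \<subseteq> V\<close> \<open>A \<noteq> {}\<close> finite_V by (auto simp: a_def card_gt_0_iff)
  then have "(a / real (card V)) powr tanh (\<rho> * t / 2) = exp (- (L * tanh (\<rho> * t / 2)))"
    by (simp add: powr_def L_def ln_div algebra_simps flip: a_def)
  then have "\<rho> * t * L / 5 \<le> 1 - (a / real (card V)) powr tanh (\<rho> * t / 2)"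
    using one_minus_exp_mult_tanh_ge[of "\<rho> * t" L] L_bounds hyp t by simp
  then have "a * (\<rho> * t * L / 5) \<le> a * (1 - (a / real (card V)) powr tanh (\<rho> * t / 2))"
    using \<open>0 < a\<close> by (intro mult_left_mono) auto
  also have "\<dots> \<le> sqrt (2 * t) * B"
    unfolding a_def B_def by (rule edge_boundary_ge_heat_loss) fact+
  also have "\<dots> = sqrt t * (sqrt 2 * B)" by (simp add: real_sqrt_mult)
  finally have "sqrt t * (a * (\<rho> * L * sqrt t)) \<le> sqrt t * (5 * sqrt 2 * B)"
    using \<open>0 < t\<close> by (simp add: algebra_simps)
  then have "a * (\<rho> * L * sqrt t) \<le> 5 * sqrt 2 * B"
    using \<open>0 < t\<close> by (simp add: mult_le_cancel_left)
  also have "\<dots> \<le> 8 * B"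
  proof -
    have "sqrt 2 \<le> 8 / 5" by (rule real_le_lsqrt) (auto simp: power2_eq_square)
    then show ?thesis by (intro mult_right_mono) (auto simp: B_def)
  qed
  finally show ?thesis by (simp add: a_def B_def)
qed

lemma hypercontractive_imp_edge_boundary_ge:
  assumes Ric: "Ric_ge V E K" and hyp: "hypercontractive V E \<rho>" "0 < \<rho>"
    and "A \<subseteq> V" "A \<noteq> {}"
  defines "L \<equiv> ln (real (card V) / real (card A))"
  assumes L_ge: "1 / 2 \<le> L"
  shows "1/16 * (if K = 0 then sqrt \<rho> else min (sqrt \<rho>) (\<rho> / sqrt (2 * \<bar>K\<bar>)))
    * real (card A) * sqrt L \<le> card (edge_boundary V E A)" (is "1/16 * ?m * _ * _ \<le> _")
proof -
  define M where "M = max (\<rho> * L) (2 * \<bar>K\<bar>)"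
  have M_ge: "\<rho> * L \<le> M" "2 * \<bar>K\<bar> \<le> M" by (simp_all add: M_def)
  moreover have "0 < \<rho> * L" using hyp L_ge by simp
  ultimately have "0 < M" by linarith
  have "real (card A) * (?m * sqrt L) \<le> real (card A) * (2 * (\<rho> * L * sqrt (1 / M)))"
    using min_sqrt_divide_sqrt_mult_le[of \<rho> "2 * \<bar>K\<bar>" L] hyp L_ge
    by (intro mult_left_mono) (simp_all add: M_def)
  moreover have "real (card A) * (\<rho> * L * sqrt (1 / M)) \<le> 8 * card (edge_boundary V E A)"
    unfolding L_def
  proof (rule edge_boundary_ge_sqrt_time[OF Ric hyp _ _ \<open>A \<subseteq> V\<close> \<open>A \<noteq> {}\<close>])
    show "- 1 \<le> 2 * K * (1 / M)" using M_ge \<open>0 < M\<close> by (simp add: field_simps abs_le_iff)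
  qed (use L_ge M_ge \<open>0 < M\<close> in \<open>simp_all add: L_def field_simps\<close>)
  ultimately show ?thesis by (simp add: algebra_simps)
qed

end

theorem theorem17:
  fixes V :: "'a set" and E :: "'a set set" and K :: real and \<rho> :: real and A :: "'a set"
  assumes "simple_graph V E" and "finite V"
    and "Ric_ge V E K"
    and "\<rho> = log_sobolev_const V E"
    and "A \<subseteq> V" and "A \<noteq> {}" and "real (card A) \<le> real (card V) / 2"
  shows "real (card (edge_boundary V E A)) \<ge>
    1/16 * (if K = 0 then sqrt \<rho> else min (sqrt \<rho>) (\<rho> / sqrt (2 * \<bar>K\<bar>)))
      * real (card A) * sqrt (ln (real (card V) / real (card A)))"
proof -
  interpret finite_graph V E
    using assms(1,2) by (simp add: finite_graph_def finite_graph_axioms_def)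
  have "finite A" using assms(2,5) by (rule rev_finite_subset)
  then have "0 < card A" using assms(6) by (simp add: card_gt_0_iff)
  then have "2 \<le> card V" using assms(7) by linarith
  then have hyp: "hypercontractive V E \<rho>" and "0 \<le> \<rho>"
    unfolding assms(4) by (rule hypercontractive_log_sobolev_const, rule log_sobolev_const_nonneg)
  have "1 / 2 \<le> ln (2::real)"
    using ln_le_minus_one[of "1 / 2 :: real"] by (simp add: ln_div)
  also have "\<dots> \<le> ln (real (card V) / real (card A))"
    using \<open>0 < card A\<close> assms(7) by (intro ln_mono) (simp_all add: field_simps)
  finally have log_ge: "1 / 2 \<le> ln (real (card V) / real (card A))" .
  show ?thesis
  proof (cases "\<rho> = 0")
    case False
    then show ?thesis
      using hypercontractive_imp_edge_boundary_ge[OF assms(3) hyp _ assms(5,6) log_ge] \<open>0 \<le> \<rho>\<close>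
      by simp
  qed simp
qed

end
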